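(* For any topological gyrogroup $G$, the function $i_G:G\to G^\bullet$ defined by $i_G(x)=x^\bullet$, where $x^\bullet(r)=x$ for all $r\in J=[0,1)$, is a topological embedding, and $i_G(G)$ forms a closed subgyrogroup of $G^\bullet$.
   Context: A gyrogroup is a nonempty set $G$ with a binary operation $\oplus$ such that: (G1) there is $e\in G$ with $e\oplus x=x=x\oplus e$ for all $x$; (G2) each $x\in G$ has an inverse $\ominus x\in G$ with $\ominus x\oplus x=e=x\oplus(\ominus x)$; (G3) for all $x,y\in G$ there is an automorphism $\mathrm{gyr}[x,y]$ of $(G,\oplus)$ such that $x\oplus(y\oplus z)=(x\oplus y)\oplus\mathrm{gyr}[x,y](z)$ for all $z\in G$; (G4) $\mathrm{gyr}[x\oplus y,y]=\mathrm{gyr}[x,y]$ for all $x,y\in G$. A subgyrogroup is a nonempty subset closed under $\oplus$ and $\ominus$. A topological gyrogroup is a gyrogroup $G$ with a topology such that $\oplus:G\times G\to G$ (product topology on $G\times G$) and $x\mapsto\ominus x$ are continuous. No separation axiom is assumed unless stated. Let $J=[0,1)$. A function $f:J\to G$ is a step function if there are reals $0=a_0<a_1<\dots<a_n=1$ such that $f$ is constant on $[a_k,a_{k+1})$ for $k=0,\dots,n-1$. $G^\bullet$ denotes the set of all step functions $J\to G$ with the pointwise operation $(f\oplus g)(r)=f(r)\oplus g(r)$; it is known that $G^\bullet$ is a gyrogroup. For an open neighborhood $U$ of $e$ in $G$ and $\varepsilon>0$, put $O(U,\varepsilon)=\{f\in G^\bullet : \mu(\{r\in J : f(r)\notin U\})<\varepsilon\}$,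 where $\mu$ is Lebesgue measure. $G^\bullet$ carries the topology with base $\{f\oplus O(U,\varepsilon) : f\in G^\bullet,\ U\in\mathcal{U},\ \varepsilon>0\}$, where $\mathcal{U}$ is an open base at $e$ in $G$ and $f\oplus O(U,\varepsilon)=\{f\oplus g : g\in O(U,\varepsilon)\}$.
   Formalization: Closedness of i_G(G) is asserted only when G is T0; without a separation axiom it is false (e.g. Z/2 with the indiscrete topology) and in fact fails for every non-T0 G. The embedding and subgyrogroup claims are for all topological gyrogroups. *)

theory Defs
  imports "HOL-Analysis.Analysis" "HOL-Algebra.Group"
begin

(* The record of HOL-Algebra serves only as a carrier with a binary operation and an identity;
   associativity is not assumed.  The operation is written \<otimes> instead of the customary \<oplus>,
   the inverse m_inv instead of \<ominus>; inverses are unique in a gyrogroup, so m_inv denotes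
   the element given by the axiom inverse. *)
locale gyrogroup =
  fixes G :: "('a, 'b) monoid_scheme" (structure)
  assumes closed: "\<lbrakk>x \<in> carrier G; y \<in> carrier G\<rbrakk> \<Longrightarrow> x \<otimes> y \<in> carrier G"
    and one_closed: "\<one> \<in> carrier G"
    and identity: "x \<in> carrier G \<Longrightarrow> \<one> \<otimes> x = x \<and> x \<otimes> \<one> = x"
    and inverse: "x \<in> carrier G \<Longrightarrow> \<exists>y\<in>carrier G. y \<otimes> x = \<one> \<and> x \<otimes> y = \<one>"
    and gyration:
      "\<exists>gyr. (\<forall>x\<in>carrier G. \<forall>y\<in>carrier G. gyr x y \<in> iso G G \<and>
                 (\<forall>z\<in>carrier G. x \<otimes> (y \<otimes> z) = (x \<otimes> y) \<otimes> gyr x y z)) \<and>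
              (\<forall>x\<in>carrier G. \<forall>y\<in>carrier G. \<forall>z\<in>carrier G. gyr (x \<otimes> y) y z = gyr x y z)"

definition subgyrogroup :: "'a set \<Rightarrow> ('a, 'b) monoid_scheme \<Rightarrow> bool" where
  "subgyrogroup H G \<longleftrightarrow> H \<noteq> {} \<and> H \<subseteq> carrier G \<and>
     (\<forall>x\<in>H. \<forall>y\<in>H. x \<otimes>\<^bsub>G\<^esub> y \<in> H) \<and> (\<forall>x\<in>H. inv\<^bsub>G\<^esub> x \<in> H)"

locale topological_gyrogroup = gyrogroup G
  for G :: "('a, 'b) monoid_scheme" (structure) +
  fixes T :: "'a topology"
  assumes topspace_eq: "topspace T = carrier G"
    and continuous_mult: "continuous_map (prod_topology T T) T (\<lambda>(x, y). x \<otimes> y)"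
    and continuous_inv: "continuous_map T T (\<lambda>x. inv x)"

definition open_base_at :: "'a topology \<Rightarrow> 'a \<Rightarrow> 'a set set \<Rightarrow> bool" where
  "open_base_at T x \<U> \<longleftrightarrow> (\<forall>U\<in>\<U>. openin T U \<and> x \<in> U) \<and>
     (\<forall>V. openin T V \<and> x \<in> V \<longrightarrow> (\<exists>U\<in>\<U>. U \<subseteq> V))"

(* A function on [0,1) is represented by its extension by undefined to all reals. *)
definition step_functions :: "'a set \<Rightarrow> (real \<Rightarrow> 'a) set" where
  "step_functions A = {f \<in> {0..<1} \<rightarrow>\<^sub>E A. \<exists>(n::nat) a. a 0 = 0 \<and> a n = 1 \<and>
     (\<forall>k<n. a k < a (Suc k) \<and> f constant_on {a k..<a (Suc k)})}"

definition step_gyrogroup :: "('a, 'b) monoid_scheme \<Rightarrow> (real \<Rightarrow> 'a) monoid" where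
  "step_gyrogroup G = \<lparr>carrier = step_functions (carrier G),
     mult = (\<lambda>f g. \<lambda>r\<in>{0..<1}. f r \<otimes>\<^bsub>G\<^esub> g r),
     one = (\<lambda>r\<in>{0..<1}. \<one>\<^bsub>G\<^esub>)\<rparr>"

definition step_nbhd :: "('a, 'b) monoid_scheme \<Rightarrow> 'a set \<Rightarrow> real \<Rightarrow> (real \<Rightarrow> 'a) set" where
  "step_nbhd G U \<epsilon> =
     {f \<in> carrier (step_gyrogroup G). measure lebesgue {r \<in> {0..<1}. f r \<notin> U} < \<epsilon>}"

definition step_base ::
  "('a, 'b) monoid_scheme \<Rightarrow> 'a set set \<Rightarrow> (real \<Rightarrow> 'a) set set" where
  "step_base G \<U> = {(\<lambda>g. f \<otimes>\<^bsub>step_gyrogroup G\<^esub> g) ` step_nbhd G U \<epsilon> | f U \<epsilon>.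
     f \<in> carrier (step_gyrogroup G) \<and> U \<in> \<U> \<and> \<epsilon> > 0}"

(* The topology whose open sets are the unions of base sets.  It is indiscrete whenever the
   topology of G is, so the constant functions need not form a closed set unless G is T0. *)
definition step_topology ::
  "('a, 'b) monoid_scheme \<Rightarrow> 'a set set \<Rightarrow> (real \<Rightarrow> 'a) topology" where
  "step_topology G \<U> = topology (arbitrary union_of (\<lambda>S. S \<in> step_base G \<U>))"

definition const_step :: "'a \<Rightarrow> real \<Rightarrow> 'a" where
  "const_step x = (\<lambda>r\<in>{0..<1}. x)"

end

(* By left cancellation, f + O(U, e) = {h. mu {r. -f(r) + h(r) not in U} < e}.  In this form the
   sets are seen to be a base of a topology using only the continuity of left translations, and
   for e <= 1 the constants in x* + O(U, e) are exactly the y* with -x + y in U, which gives the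
   embedding.  For closedness, right cancellation b = (b + w) - gyr[b + w, w] w is continuous
   in (b + w, w), so in a T0 gyrogroup distinct points a, b have disjoint neighbourhoods a + V and
   b + V; a constant cannot be close to a step function that takes both values. *)

theory Submission
  imports Defs
begin

text \<open>The lack of associativity is felt twice. A base set containing \<open>h\<close> must
  contain one centred at \<open>h\<close>: given \<open>inv x \<otimes> y \<in> U\<close> with
  \<open>x = f r\<close> and \<open>y = h r\<close>, one wants
  \<open>inv x \<otimes> (y \<otimes> z) \<in> U\<close> for all \<open>z\<close> near
  \<open>\<one>\<close>. How near depends on the pair \<open>(x, y)\<close>, and the finite range of
  step functions makes one choice serve all \<open>r\<close>. Secondly,
  \<open>a \<otimes> v = b \<otimes> w\<close> cannot be regrouped to compare \<open>a\<close> with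
  \<open>b\<close>. Solving for \<open>b\<close> produces \<open>gyr b w\<close>, which involves the
  unknown \<open>b\<close>; axiom (G4) turns it into \<open>gyr (b \<otimes> w) w\<close>, an
  expression in the common point and \<open>w\<close> alone. It is continuous because a gyration is
  itself composed of products and inverses.\<close>

section \<open>Step functions: level sets, jump sets, pointwise combination\<close>

lemma step_partition_mono:
  fixes a :: "nat \<Rightarrow> real"
  assumes "\<And>k. k < n \<Longrightarrow> a k < a (Suc k)" "i \<le> j" "j \<le> n"
  shows "a i \<le> a j"
  using assms(2,3)
proof (induction j rule: dec_induct)
  case (step m)
  then show ?case using assms(1)[of m] by force
qed simp

lemma step_partition_cover:
  fixes a :: "nat \<Rightarrow> real"
  assumes "a 0 = 0" "a n = 1" "0 \<le> r" "r < 1"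
  shows "\<exists>k<n. a k \<le> r \<and> r < a (Suc k)"
proof -
  define m where "m = (LEAST k. r < a k)"
  have m: "r < a m" "m \<le> n"
    unfolding m_def using assms by (auto intro: LeastI[of _ n] Least_le)
  then obtain k where k: "m = Suc k" using assms by (cases m) auto
  then have "\<not> r < a k" unfolding m_def using not_less_Least[of k "\<lambda>k. r < a k"] by simp
  then show ?thesis using m k by (intro exI[of _ k]) auto
qed

text \<open>A condition on \<open>f r\<close> holds or fails on whole partition intervals, so it
  defines a finite union of half-open intervals. Measurability matters because
  \<open>measure\<close> is 0 on nonmeasurable sets and so is not monotone in general. Positivity
  holds because each value is kept on an interval of positive length; it later supplies the radius
  in the proof of closedness.\<close>

lemma step_functions_values:
  assumes "f \<in> step_functions A"
  shows finite_image_step_function: "finite (f ` {0..<1})"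
    and lmeasurable_step_function: "{r \<in> {0..<1}. P (f r)} \<in> lmeasurable"
    and measure_level_set_pos: "r \<in> {0..<1} \<Longrightarrow> measure lebesgue {t \<in> {0..<1}. f t = f r} > 0"
proof -
  obtain n a where a: "a (0::nat) = (0::real)" "a n = 1" "\<And>k. k < n \<Longrightarrow> a k < a (Suc k)"
    and "\<And>k. k < n \<Longrightarrow> f constant_on {a k..<a (Suc k)}"
    using assms unfolding step_functions_def by blast
  then have f: "f r = f (a k)" if "k < n" "a k \<le> r" "r < a (Suc k)" for k r
    using that unfolding constant_on_def by (metis atLeastLessThan_iff order.refl order.strict_trans1)
  have cover: "\<exists>k<n. a k \<le> r \<and> r < a (Suc k)" if "r \<in> {0..<1}" for r
    using step_partition_cover[OF a(1,2)] that by simp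
  have sub: "{a k..<a (Suc k)} \<subseteq> {0..<1}" if "k < n" for k
    using step_partition_mono[where a = a and n = n and i = 0 and j = k, OF a(3)]
      step_partition_mono[where a = a and n = n and i = "Suc k" and j = n, OF a(3)] that a by auto
  show "finite (f ` {0..<1})"
  proof (rule finite_subset)
    show "f ` {0..<1} \<subseteq> (\<lambda>k. f (a k)) ` {..<n}"
      using cover f by (metis image_eqI image_subsetI lessThan_iff)
  qed simp
  have meas: "{r \<in> {0..<1}. P (f r)} \<in> lmeasurable" for P
  proof -
    have "{r \<in> {0..<1}. P (f r)} = (\<Union>k\<in>{k. k < n \<and> P (f (a k))}. {a k..<a (Suc k)})" (is "?L = ?R")
    proof
      show "?L \<subseteq> ?R"
      proof
        fix r assume r: "r \<in> ?L"
        then obtain k where "k < n" "a k \<le> r" "r < a (Suc k)" using cover by blast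
        then show "r \<in> ?R" using f[of k r] r by auto
      qed
      show "?R \<subseteq> ?L"
      proof
        fix r assume "r \<in> ?R"
        then obtain k where k: "k < n" "P (f (a k))" "r \<in> {a k..<a (Suc k)}" by auto
        then show "r \<in> ?L" using f[of k r] sub[of k] by auto
      qed
    qed
    also have "\<dots> \<in> lmeasurable"
      by (intro fmeasurable.finite_UN) (auto intro: bounded_set_imp_lmeasurable)
    finally show ?thesis .
  qed
  then show "{r \<in> {0..<1}. P (f r)} \<in> lmeasurable" .
  assume "r \<in> {0..<1}"
  then obtain k where k: "k < n" "a k \<le> r" "r < a (Suc k)" using cover by blast
  have "0 < measure lebesgue {a k..<a (Suc k)}" using a(3) k by simp
  also have "\<dots> \<le> measure lebesgue {t \<in> {0..<1}. f t = f r}"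
  proof (intro measure_mono_fmeasurable meas subsetI)
    fix t assume t: "t \<in> {a k..<a (Suc k)}"
    then have "f t = f (a k)" using f[of k t] k by simp
    also have "\<dots> = f r" using f[of k r] k by simp
    finally show "t \<in> {t \<in> {0..<1}. f t = f r}" using sub[OF k(1)] t by auto
  qed simp
  finally show "measure lebesgue {t \<in> {0..<1}. f t = f r} > 0" .
qed

text \<open>In terms of jump sets, a common refinement of two partitions is just a union.\<close>

lemma step_functions_iff_jumps:
  "f \<in> step_functions A \<longleftrightarrow> f \<in> {0..<1} \<rightarrow>\<^sub>E A \<and>
     (\<exists>S. finite S \<and> (\<forall>x y. 0 \<le> x \<longrightarrow> x \<le> y \<longrightarrow> y < 1 \<longrightarrow> S \<inter> {x<..y} = {} \<longrightarrow> f x = f y))"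
  (is "_ \<longleftrightarrow> _ \<and> (\<exists>S. ?jumps S)")
proof (intro iffI conjI)
  assume step: "f \<in> step_functions A"
  then show "f \<in> {0..<1} \<rightarrow>\<^sub>E A" unfolding step_functions_def by blast
  obtain n a where a: "a (0::nat) = (0::real)" "a n = 1" "\<And>k. k < n \<Longrightarrow> a k < a (Suc k)"
    and f: "\<And>k. k < n \<Longrightarrow> f constant_on {a k..<a (Suc k)}"
    using step unfolding step_functions_def by blast
  \<comment> \<open>The interval \<open>{x<..y}\<close> omits \<open>x\<close> because pieces are
    closed on the left: a partition point at \<open>x\<close> starts the piece containing
    \<open>x\<close>, whereas one at \<open>y\<close> separates \<open>y\<close> from
    \<open>x\<close>.\<close>
  have "?jumps (a ` {..n})"
  proof (intro conjI allI impI)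
    fix x y :: real assume xy: "0 \<le> x" "x \<le> y" "y < 1" and disj: "a ` {..n} \<inter> {x<..y} = {}"
    then obtain k where k: "k < n" "a k \<le> x" "x < a (Suc k)"
      using step_partition_cover[OF a(1,2), of x] by auto
    have "a (Suc k) \<in> a ` {..n}" using k by auto
    then have "a (Suc k) \<notin> {x<..y}" using disj by blast
    then have "y < a (Suc k)" using k by auto
    then show "f x = f y" using f[OF k(1)] k xy unfolding constant_on_def by auto
  qed simp
  then show "\<exists>S. ?jumps S" by blast
next
  assume "f \<in> {0..<1} \<rightarrow>\<^sub>E A \<and> (\<exists>S. ?jumps S)"
  then obtain S where f: "f \<in> {0..<1} \<rightarrow>\<^sub>E A" and S: "finite S"
    and jumps: "\<And>x y. 0 \<le> x \<Longrightarrow> x \<le> y \<Longrightarrow> y < 1 \<Longrightarrow> S \<inter> {x<..y} = {} \<Longrightarrow> f x = f y" by blast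
  \<comment> \<open>Jumps outside \<open>{0..1}\<close> are dropped and both endpoints added, so
    that the sorted list of \<open>B\<close> begins with 0, ends with 1 and is itself the required
    partition.\<close>
  define B where "B = insert 0 (insert 1 (S \<inter> {0..1}))"
  define l where "l = sorted_list_of_set B"
  have B: "finite B" "0 \<in> B" "1 \<in> B" "B \<subseteq> {0..1}" unfolding B_def using S by auto
  have set: "set l = B" and sorted: "sorted_wrt (<) l"
    unfolding l_def using B by auto
  define n where "n = length l - 1"
  have len: "length l = Suc n" using set B unfolding n_def by (cases l) auto
  have less: "l ! i < l ! j" if "i < j" "j \<le> n" for i j
    using sorted_wrt_nth_less[OF sorted that(1)] that len by simp
  have inB: "l ! i \<in> B" if "i \<le> n" for i using that len set nth_mem[of i l] by simp
  obtain i where i: "i \<le> n" "l ! i = 0" using B(2) len set by (metis in_set_conv_nth less_Suc_eq_le)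
  obtain j where j: "j \<le> n" "l ! j = 1" using B(3) len set by (metis in_set_conv_nth less_Suc_eq_le)
  have l0: "l ! 0 = 0" using i less[of 0 i] inB[of 0] B(4) by (cases "i = 0") auto
  have ln: "l ! n = 1" using j less[of j n] inB[of n] B(4) by (cases "j = n") auto
  have "f constant_on {l ! k..<l ! Suc k}" if k: "k < n" for k
  proof -
    have "f (l ! k) = f x" if x: "l ! k \<le> x" "x < l ! Suc k" for x
    proof (rule jumps)
      show "0 \<le> l ! k" "x < 1" using inB[of k] inB[of "Suc k"] k B(4) x by auto
      \<comment> \<open>A jump here would be an element of \<open>B\<close> strictly between two
        consecutive entries of the sorted list.\<close>
      show "S \<inter> {l ! k<..x} = {}"
      proof (rule ccontr)
        assume "S \<inter> {l ! k<..x} \<noteq> {}"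
        then obtain s where s: "s \<in> S" "l ! k < s" "s \<le> x" by auto
        then have "s \<in> B" using inB[of k] inB[of "Suc k"] k B(4) x unfolding B_def by auto
        then obtain m where m: "m \<le> n" "l ! m = s" using len set by (metis in_set_conv_nth less_Suc_eq_le)
        show False
        proof (cases "m \<le> k")
          case True
          then show ?thesis using less[of m k] m s k by (cases "m = k") auto
        next
          case False
          then show ?thesis using less[of "Suc k" m] m s x by (cases "m = Suc k") auto
        qed
      qed
    qed (use x in simp)
    then show ?thesis unfolding constant_on_def by (metis atLeastLessThan_iff)
  qed
  then show "f \<in> step_functions A"
    unfolding step_functions_def using f l0 ln less
    by (intro CollectI conjI exI[of _ n] exI[of _ "\<lambda>k. l ! k"]) auto
qed

text \<open>Applied to the product it gives closure of the step functions; applied to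
  \<open>inv x \<otimes> y\<close> it also makes the exceptional sets of two step functions
  measurable.\<close>

lemma step_functions_combine:
  assumes f: "f \<in> step_functions A" and g: "g \<in> step_functions B"
    and h: "\<And>x y. x \<in> A \<Longrightarrow> y \<in> B \<Longrightarrow> h x y \<in> C"
  shows "(\<lambda>r\<in>{0..<1}. h (f r) (g r)) \<in> step_functions C"
proof -
  obtain S where S: "finite S"
    "\<And>x y. 0 \<le> x \<Longrightarrow> x \<le> y \<Longrightarrow> y < 1 \<Longrightarrow> S \<inter> {x<..y} = {} \<Longrightarrow> f x = f y"
    using f unfolding step_functions_iff_jumps by blast
  obtain S' where S': "finite S'"
    "\<And>x y. 0 \<le> x \<Longrightarrow> x \<le> y \<Longrightarrow> y < 1 \<Longrightarrow> S' \<inter> {x<..y} = {} \<Longrightarrow> g x = g y"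
    using g unfolding step_functions_iff_jumps by blast
  have fg: "f \<in> {0..<1} \<rightarrow>\<^sub>E A" "g \<in> {0..<1} \<rightarrow>\<^sub>E B" using f g unfolding step_functions_def by auto
  show ?thesis
    unfolding step_functions_iff_jumps
  proof (intro conjI exI[of _ "S \<union> S'"] allI impI)
    show "(\<lambda>r\<in>{0..<1}. h (f r) (g r)) \<in> {0..<1} \<rightarrow>\<^sub>E C"
      using h fg by (auto simp: PiE_iff)
    fix x y :: real assume xy: "0 \<le> x" "x \<le> y" "y < 1" "(S \<union> S') \<inter> {x<..y} = {}"
    then have "S \<inter> {x<..y} = {}" "S' \<inter> {x<..y} = {}" by auto
    then have "f x = f y" "g x = g y" using S(2) S'(2) xy by auto
    then show "(\<lambda>r\<in>{0..<1}. h (f r) (g r)) x = (\<lambda>r\<in>{0..<1}. h (f r) (g r)) y"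
      using xy by simp
  qed (use S S' in simp)
qed

lemma const_step_in_step_functions [intro]: "x \<in> A \<Longrightarrow> const_step x \<in> step_functions A"
  unfolding step_functions_iff_jumps const_step_def by (auto intro: exI[of _ "{}"])

lemma step_functions_value: "f \<in> step_functions A \<Longrightarrow> r \<in> {0..<1} \<Longrightarrow> f r \<in> A"
  unfolding step_functions_def by auto

lemma step_functions_eqI:
  assumes "f \<in> step_functions A" "g \<in> step_functions B" "\<And>r. r \<in> {0..<1} \<Longrightarrow> f r = g r"
  shows "f = g"
  using assms PiE_ext[of f "{0..<1}" "\<lambda>_. A \<union> B" g] unfolding step_functions_def by (auto simp: PiE_iff extensional_def)

section \<open>Cancellation laws in a gyrogroup\<close>

context gyrogroup
begin

text \<open>As \<open>y \<otimes> x = \<one>\<close>, (G3) gives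
  \<open>y \<otimes> (x \<otimes> u) = gyr y x u\<close>, and (G4) gives
  \<open>gyr \<one> x = gyr y x\<close>; it remains to see that \<open>gyr \<one> x\<close> fixes
  \<open>z\<close>. Reassociating \<open>\<one> \<otimes> (x \<otimes> z)\<close> yields
  \<open>x \<otimes> z = x \<otimes> gyr \<one> x z\<close>. The factor \<open>x\<close> cannot be
  cancelled yet, but multiplying by \<open>y\<close> on the left turns both sides into values of the
  injective map \<open>gyr y x\<close>.\<close>

lemma left_cancel:
  assumes "x \<in> carrier G" "y \<in> carrier G" "z \<in> carrier G" "y \<otimes> x = \<one>"
  shows "y \<otimes> (x \<otimes> z) = z"
proof -
  obtain gyr where auto: "\<And>x y. x \<in> carrier G \<Longrightarrow> y \<in> carrier G \<Longrightarrow> gyr x y \<in> iso G G"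
    and assoc: "\<And>x y z. x \<in> carrier G \<Longrightarrow> y \<in> carrier G \<Longrightarrow> z \<in> carrier G \<Longrightarrow>
        x \<otimes> (y \<otimes> z) = (x \<otimes> y) \<otimes> gyr x y z"
    and loop: "\<And>x y z. x \<in> carrier G \<Longrightarrow> y \<in> carrier G \<Longrightarrow> z \<in> carrier G \<Longrightarrow>
        gyr (x \<otimes> y) y z = gyr x y z"
    using gyration by blast
  have bij: "bij_betw (gyr u v) (carrier G) (carrier G)"
    if "u \<in> carrier G" "v \<in> carrier G" for u v
    using auto[OF that] unfolding iso_def by simp
  note gyr_closed = bij_betw_apply[OF bij]
  have gyr: "y \<otimes> (x \<otimes> u) = gyr y x u" if "u \<in> carrier G" for u
    using assoc[of y x u] assms that identity[of "gyr y x u"] gyr_closed[of y x u] by simp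
  have "x \<otimes> z = x \<otimes> gyr \<one> x z"
    using assoc[of \<one> x z] assms one_closed closed[of x z] identity[of x] identity[of "x \<otimes> z"]
    by simp
  then have "gyr y x z = gyr y x (gyr \<one> x z)"
    using gyr assms gyr_closed one_closed by metis
  then have "z = gyr \<one> x z"
    using bij[of y x] assms gyr_closed one_closed unfolding bij_betw_def
    by (metis inj_onD)
  also have "\<dots> = gyr y x z" using loop[of y x z] assms by simp
  also have "\<dots> = y \<otimes> (x \<otimes> z)" using gyr assms by simp
  finally show ?thesis by simp
qed

lemma inverse_unique:
  assumes "x \<in> carrier G" "y \<in> carrier G" "z \<in> carrier G" "y \<otimes> x = \<one>" "x \<otimes> z = \<one>"
  shows "y = z"
  using left_cancel[of x y z] assms identity[of y] by simp

lemma inv_eqI: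
  assumes "x \<in> carrier G" "y \<in> carrier G" "y \<otimes> x = \<one>" "x \<otimes> y = \<one>"
  shows "inv x = y"
  unfolding m_inv_def
  by (rule the_equality) (use assms inverse_unique in auto)

lemma inv_props:
  assumes "x \<in> carrier G"
  shows inv_carrier: "inv x \<in> carrier G" and inv_left: "inv x \<otimes> x = \<one>"
    and inv_right: "x \<otimes> inv x = \<one>"
proof -
  obtain y where "y \<in> carrier G" "y \<otimes> x = \<one>" "x \<otimes> y = \<one>" using inverse assms by blast
  then show "inv x \<in> carrier G" "inv x \<otimes> x = \<one>" "x \<otimes> inv x = \<one>"
    using inv_eqI[OF assms] by auto
qed

lemma inv_mult_cancel:
  assumes "x \<in> carrier G" "y \<in> carrier G"
  shows "inv x \<otimes> (x \<otimes> y) = y" "x \<otimes> (inv x \<otimes> y) = y"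
  using left_cancel assms inv_props by auto

text \<open>Since \<open>gyr x w z = inv (x \<otimes> w) \<otimes> (x \<otimes> (w \<otimes> z))\<close>, the left-hand side is
  \<open>x \<otimes> inv (gyr x w w)\<close>, written so that its continuity in \<open>x\<close> and \<open>w\<close> is evident.\<close>

lemma right_cancel:
  assumes b: "b \<in> carrier G" and w: "w \<in> carrier G" and x: "x = b \<otimes> w"
  shows "x \<otimes> inv (inv (x \<otimes> w) \<otimes> (x \<otimes> (w \<otimes> w))) = b"
proof -
  obtain gyr where auto: "\<And>x y. x \<in> carrier G \<Longrightarrow> y \<in> carrier G \<Longrightarrow> gyr x y \<in> iso G G"
    and assoc: "\<And>x y z. x \<in> carrier G \<Longrightarrow> y \<in> carrier G \<Longrightarrow> z \<in> carrier G \<Longrightarrow>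
        x \<otimes> (y \<otimes> z) = (x \<otimes> y) \<otimes> gyr x y z"
    and loop: "\<And>x y z. x \<in> carrier G \<Longrightarrow> y \<in> carrier G \<Longrightarrow> z \<in> carrier G \<Longrightarrow>
        gyr (x \<otimes> y) y z = gyr x y z"
    using gyration by blast
  \<comment> \<open>By (G4), \<open>p\<close> agrees with \<open>gyr x w\<close> on the carrier. It
    is also the gyration that arises in reassociating
    \<open>b \<otimes> (w \<otimes> inv w)\<close>, which is how
    \<open>x \<otimes> p (inv w)\<close> collapses to \<open>b\<close>.\<close>
  define p where "p = gyr b w"
  have p: "p \<in> iso G G" using auto b w unfolding p_def by simp
  have hom: "p (u \<otimes> v) = p u \<otimes> p v" if "u \<in> carrier G" "v \<in> carrier G" for u v
    using p that unfolding iso_def hom_def by blast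
  have pc: "p u \<in> carrier G" if "u \<in> carrier G" for u
    using p that unfolding iso_def hom_def by blast
  \<comment> \<open>\<open>p \<one>\<close> is idempotent, and left cancellation leaves
    \<open>\<one>\<close> as the only idempotent.\<close>
  have p1: "p \<one> = \<one>"
    using inv_mult_cancel(1)[of "p \<one>" "p \<one>"] hom[of \<one> \<one>] identity[of \<one>] one_closed pc
      inv_left[of "p \<one>"] by simp
  have xc: "x \<in> carrier G" using closed b w x by simp
  have "x \<otimes> (w \<otimes> w) = (x \<otimes> w) \<otimes> p w"
    using assoc[OF xc w w] loop[OF b w w] x unfolding p_def by simp
  then have "inv (x \<otimes> w) \<otimes> (x \<otimes> (w \<otimes> w)) = p w"
    using inv_mult_cancel(1) closed xc w pc by simp
  moreover have "inv (p w) = p (inv w)"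
    using inv_props[OF w] p1 w by (intro inv_eqI) (auto simp: pc simp flip: hom)
  moreover have "x \<otimes> p (inv w) = b \<otimes> (w \<otimes> inv w)"
    using assoc[of b w "inv w"] b w x inv_carrier unfolding p_def by simp
  ultimately show ?thesis using inv_right[OF w] identity[OF b] by simp
qed

section \<open>The step gyrogroup: translates, inverses of constants\<close>

lemma step_mult_closed:
  assumes "f \<in> carrier (step_gyrogroup G)" "g \<in> carrier (step_gyrogroup G)"
  shows "f \<otimes>\<^bsub>step_gyrogroup G\<^esub> g \<in> carrier (step_gyrogroup G)"
  using step_functions_combine[of f "carrier G" g "carrier G" "\<lambda>x y. x \<otimes> y"] assms closed
  by (simp add: step_gyrogroup_def)

lemma step_translate_eq:
  assumes f: "f \<in> carrier (step_gyrogroup G)"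
  shows "(\<lambda>g. f \<otimes>\<^bsub>step_gyrogroup G\<^esub> g) ` step_nbhd G U \<epsilon> =
    {h \<in> carrier (step_gyrogroup G). measure lebesgue {r \<in> {0..<1}. inv (f r) \<otimes> h r \<notin> U} < \<epsilon>}"
    (is "?L = ?R")
proof
  have fc: "f r \<in> carrier G" if "r \<in> {0..<1}" for r
    using step_functions_value[of f "carrier G"] f that by (simp add: step_gyrogroup_def)
  show "?L \<subseteq> ?R"
  proof
    fix h assume "h \<in> ?L"
    then obtain g where g: "g \<in> carrier (step_gyrogroup G)" and h: "h = f \<otimes>\<^bsub>step_gyrogroup G\<^esub> g"
      and less: "measure lebesgue {r \<in> {0..<1}. g r \<notin> U} < \<epsilon>"
      unfolding step_nbhd_def by blast
    have gc: "g r \<in> carrier G" if "r \<in> {0..<1}" for r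
      using step_functions_value[of g "carrier G"] g that by (simp add: step_gyrogroup_def)
    have "inv (f r) \<otimes> h r = g r" if "r \<in> {0..<1}" for r
      using that h inv_mult_cancel(1)[OF fc gc, of r r] by (simp add: step_gyrogroup_def)
    then have "{r \<in> {0..<1}. inv (f r) \<otimes> h r \<notin> U} = {r \<in> {0..<1}. g r \<notin> U}" by auto
    then show "h \<in> ?R" using less h step_mult_closed[OF f g] by simp
  qed
  show "?R \<subseteq> ?L"
  proof
    fix h assume "h \<in> ?R"
    then have h: "h \<in> step_functions (carrier G)"
      and less: "measure lebesgue {r \<in> {0..<1}. inv (f r) \<otimes> h r \<notin> U} < \<epsilon>"
      by (auto simp: step_gyrogroup_def)
    define g where "g = (\<lambda>r\<in>{0..<1}. inv (f r) \<otimes> h r)"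
    have g: "g \<in> step_functions (carrier G)"
      unfolding g_def
      using step_functions_combine[of f "carrier G" h "carrier G" "\<lambda>x y. inv x \<otimes> y"] f h closed inv_carrier
      by (simp add: step_gyrogroup_def)
    have "h = f \<otimes>\<^bsub>step_gyrogroup G\<^esub> g"
    proof (rule step_functions_eqI[OF h])
      show "f \<otimes>\<^bsub>step_gyrogroup G\<^esub> g \<in> step_functions (carrier G)"
        using step_mult_closed[OF f, of g] g by (simp add: step_gyrogroup_def)
      show "h r = (f \<otimes>\<^bsub>step_gyrogroup G\<^esub> g) r" if "r \<in> {0..<1}" for r
        using that inv_mult_cancel(2)[OF fc step_functions_value[OF h], of r r]
        by (simp add: step_gyrogroup_def g_def)
    qed
    moreover have "{r \<in> {0..<1}. g r \<notin> U} = {r \<in> {0..<1}. inv (f r) \<otimes> h r \<notin> U}"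
      unfolding g_def by auto
    ultimately show "h \<in> ?L" using less g unfolding step_nbhd_def by (auto simp: step_gyrogroup_def)
  qed
qed

lemma const_step_carrier: "x \<in> carrier G \<Longrightarrow> const_step x \<in> carrier (step_gyrogroup G)"
  by (auto simp: step_gyrogroup_def)

text \<open>\<open>m_inv\<close> is a definite description, so uniqueness in the step gyrogroup has
  to be shown too; evaluation at each \<open>r\<close> reduces it to uniqueness of inverses in
  \<open>G\<close>.\<close>

lemma inv_const_step:
  assumes x: "x \<in> carrier G"
  shows "inv\<^bsub>step_gyrogroup G\<^esub> (const_step x) = const_step (inv x)"
  unfolding m_inv_def[of "step_gyrogroup G"]
proof (rule the_equality)
  show "const_step (inv x) \<in> carrier (step_gyrogroup G) \<and>
      const_step x \<otimes>\<^bsub>step_gyrogroup G\<^esub> const_step (inv x) = \<one>\<^bsub>step_gyrogroup G\<^esub> \<and>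
      const_step (inv x) \<otimes>\<^bsub>step_gyrogroup G\<^esub> const_step x = \<one>\<^bsub>step_gyrogroup G\<^esub>"
    using inv_props[OF x] const_step_in_step_functions[of "inv x" "carrier G"]
    by (auto simp: step_gyrogroup_def const_step_def intro!: restrict_ext)
next
  fix g assume g: "g \<in> carrier (step_gyrogroup G) \<and>
      const_step x \<otimes>\<^bsub>step_gyrogroup G\<^esub> g = \<one>\<^bsub>step_gyrogroup G\<^esub> \<and>
      g \<otimes>\<^bsub>step_gyrogroup G\<^esub> const_step x = \<one>\<^bsub>step_gyrogroup G\<^esub>"
  then have gs: "g \<in> step_functions (carrier G)" by (simp add: step_gyrogroup_def)
  show "g = const_step (inv x)"
  proof (rule step_functions_eqI[OF gs])
    show "const_step (inv x) \<in> step_functions (carrier G)" using inv_carrier x by auto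
    fix r :: real assume r: "r \<in> {0..<1}"
    have "(const_step x \<otimes>\<^bsub>step_gyrogroup G\<^esub> g) r = \<one>\<^bsub>step_gyrogroup G\<^esub> r" using g by simp
    then have "x \<otimes> g r = \<one>" using r by (simp add: step_gyrogroup_def const_step_def)
    then have "inv x = g r"
      using inverse_unique[of x "inv x" "g r"] inv_props[OF x] x step_functions_value[OF gs r] by simp
    then show "g r = const_step (inv x) r" using r by (simp add: const_step_def)
  qed
qed

lemma subgyrogroup_const_step:
  "subgyrogroup (const_step ` carrier G) (step_gyrogroup G)"
  unfolding subgyrogroup_def
proof (intro conjI ballI)
  show "const_step ` carrier G \<noteq> {}" using one_closed by blast
  show "const_step ` carrier G \<subseteq> carrier (step_gyrogroup G)"
    by (auto simp: step_gyrogroup_def)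
  fix f assume f: "f \<in> const_step ` carrier G"
  then show "inv\<^bsub>step_gyrogroup G\<^esub> f \<in> const_step ` carrier G"
    using inv_const_step inv_carrier by auto
  fix g assume "g \<in> const_step ` carrier G"
  then obtain x y where "f = const_step x" "g = const_step y" "x \<in> carrier G" "y \<in> carrier G"
    using f by blast
  moreover have "const_step x \<otimes>\<^bsub>step_gyrogroup G\<^esub> const_step y = const_step (x \<otimes> y)"
    by (auto simp: step_gyrogroup_def const_step_def intro!: restrict_ext)
  ultimately show "f \<otimes>\<^bsub>step_gyrogroup G\<^esub> g \<in> const_step ` carrier G"
    using closed by auto
qed

end

section \<open>Separation in a T0 topological gyrogroup\<close>

context topological_gyrogroup
begin

lemma continuous_map_mult:
  assumes "continuous_map X T f" "continuous_map X T g"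
  shows "continuous_map X T (\<lambda>x. f x \<otimes> g x)"
  using continuous_map_compose[OF _ continuous_mult, of X "\<lambda>x. (f x, g x)"] assms
  by (simp add: continuous_map_pairwise o_def)

lemma continuous_map_inv:
  "continuous_map X T f \<Longrightarrow> continuous_map X T (\<lambda>x. inv (f x))"
  using continuous_map_compose[OF _ continuous_inv, of X f] by (simp add: o_def)

lemma openin_preimage_left_mult:
  assumes "openin T U" "x \<in> carrier G"
  shows "openin T {z \<in> carrier G. x \<otimes> z \<in> U}"
  using openin_continuous_map_preimage[OF continuous_map_mult[of T "\<lambda>_. x" "\<lambda>z. z"] assms(1)]
    assms(2) topspace_eq by simp

text \<open>The map \<open>\<psi>\<close> recovers \<open>b\<close> from
  \<open>b \<otimes> w\<close> and \<open>w\<close>. By continuity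
  \<open>\<psi> (a \<otimes> v) w\<close> stays in a neighbourhood \<open>A\<close> of
  \<open>a\<close> for small \<open>v\<close> and \<open>w\<close>; at a common point of the two
  translates it would equal \<open>b\<close>, which lies outside \<open>A\<close>.\<close>

lemma separate_translates:
  assumes t0: "t0_space T" and ab: "a \<in> carrier G" "b \<in> carrier G" "a \<noteq> b"
  obtains V where "openin T V" "\<one> \<in> V" "\<And>v w. v \<in> V \<Longrightarrow> w \<in> V \<Longrightarrow> a \<otimes> v \<noteq> b \<otimes> w"
proof -
  \<comment> \<open>T0 does not say which of the two points has a neighbourhood missing the other.
    The claim is therefore proved for any ordered pair; using the same \<open>V\<close> on both
    sides makes its conclusion symmetric.\<close>
  have *: "\<exists>V. openin T V \<and> \<one> \<in> V \<and> (\<forall>v\<in>V. \<forall>w\<in>V. a \<otimes> v \<noteq> b \<otimes> w)"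
    if A: "openin T A" "a \<in> A" "b \<notin> A" and ab: "a \<in> carrier G" "b \<in> carrier G" for a b A
  proof -
    define \<psi> where "\<psi> x w = x \<otimes> inv (inv (x \<otimes> w) \<otimes> (x \<otimes> (w \<otimes> w)))" for x w
    have "continuous_map (prod_topology T T) T (\<lambda>p. \<psi> (a \<otimes> fst p) (snd p))"
      unfolding \<psi>_def
      by (intro continuous_map_mult continuous_map_inv continuous_map_fst continuous_map_snd)
        (use ab topspace_eq in auto)
    from openin_continuous_map_preimage[OF this A(1)]
    have W: "openin (prod_topology T T)
        {p \<in> carrier G \<times> carrier G. \<psi> (a \<otimes> fst p) (snd p) \<in> A}" (is "openin _ ?W")
      by (simp add: topspace_eq)
    have "\<psi> (a \<otimes> \<one>) \<one> = a"
      unfolding \<psi>_def using right_cancel[of a \<one>] ab one_closed by simp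
    then have "(\<one>, \<one>) \<in> ?W" using A one_closed by simp
    from W[unfolded openin_prod_topology_alt, rule_format, OF this]
    obtain V1 V2 where V: "openin T V1" "openin T V2" "\<one> \<in> V1" "\<one> \<in> V2" "V1 \<times> V2 \<subseteq> ?W"
      by (elim exE conjE)
    have "a \<otimes> v \<noteq> b \<otimes> w" if "v \<in> V1" "w \<in> V2" for v w
    proof
      assume eq: "a \<otimes> v = b \<otimes> w"
      have "(v, w) \<in> ?W" using that V by blast
      \<comment> \<open>The point is now read as \<open>b \<otimes> w\<close>, so
        \<open>right_cancel\<close> returns \<open>b\<close>.\<close>
      moreover have "\<psi> (a \<otimes> v) w = b"
        unfolding \<psi>_def using calculation ab eq by (intro right_cancel) auto
      ultimately show False using A(3) by simp
    qed
    then show ?thesis using V by (intro exI[of _ "V1 \<inter> V2"]) auto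
  qed
  obtain A where A: "openin T A" "a \<in> A \<longleftrightarrow> b \<notin> A"
    using t0 ab topspace_eq unfolding t0_space_def by metis
  show ?thesis
  proof (cases "a \<in> A")
    case True
    then show ?thesis using *[of A a b] A ab that by metis
  next
    case False
    then show ?thesis using *[of A b a] A ab that by metis
  qed
qed

end

section \<open>Balls and open sets of the step topology\<close>

locale topological_gyrogroup_base = topological_gyrogroup +
  fixes \<U> :: "'a set set"
  assumes base: "open_base_at T \<one> \<U>"
begin

text \<open>\<open>U\<close> may be any set: refinements are first found with an arbitrary open
  neighbourhood of \<open>\<one>\<close> and only then shrunk to a member of
  \<open>\<U>\<close>.\<close>

abbreviation step_ball :: "(real \<Rightarrow> 'a) \<Rightarrow> 'a set \<Rightarrow> real \<Rightarrow> (real \<Rightarrow> 'a) set" where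
  "step_ball f U \<epsilon> \<equiv> (\<lambda>g. f \<otimes>\<^bsub>step_gyrogroup G\<^esub> g) ` step_nbhd G U \<epsilon>"

lemma base_open: "U \<in> \<U> \<Longrightarrow> openin T U" and base_one: "U \<in> \<U> \<Longrightarrow> \<one> \<in> U"
  using base unfolding open_base_at_def by auto

lemma base_refine: "openin T V \<Longrightarrow> \<one> \<in> V \<Longrightarrow> \<exists>U\<in>\<U>. U \<subseteq> V"
  using base unfolding open_base_at_def by auto

lemma base_nonempty: "\<exists>U. U \<in> \<U>"
  using base_refine[OF openin_topspace] topspace_eq one_closed by auto

lemma step_ball_centre:
  assumes "f \<in> carrier (step_gyrogroup G)" "U \<in> \<U>" "\<epsilon> > 0"
  shows "f \<in> step_ball f U \<epsilon>"
proof -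
  have "inv (f r) \<otimes> f r \<in> U" if "r \<in> {0..<1}" for r
    using inv_left[of "f r"] step_functions_value[of f "carrier G" r] assms base_one that
    by (simp add: step_gyrogroup_def)
  then have eq: "{r \<in> {0..<1}. inv (f r) \<otimes> f r \<notin> U} = {}" by auto
  have "measure lebesgue {r \<in> {0..<1}. inv (f r) \<otimes> f r \<notin> U} < \<epsilon>"
    unfolding eq using assms by simp
  then show ?thesis using assms by (simp add: step_translate_eq)
qed

text \<open>Only finitely many pairs \<open>(f r, h r)\<close> occur, so finitely many conditions on the
  neighbourhood \<open>V\<close> suffice.\<close>

lemma step_ball_refine:
  assumes f: "f \<in> carrier (step_gyrogroup G)" and U: "U \<in> \<U>" and h: "h \<in> step_ball f U \<epsilon>"
  shows "\<exists>V \<delta>. openin T V \<and> \<one> \<in> V \<and> \<delta> > 0 \<and> step_ball h V \<delta> \<subseteq> step_ball f U \<epsilon>"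
proof -
  have h': "h \<in> carrier (step_gyrogroup G)"
    and less: "measure lebesgue {r \<in> {0..<1}. inv (f r) \<otimes> h r \<notin> U} < \<epsilon>"
    using h f by (auto simp: step_translate_eq)
  have fs: "f \<in> step_functions (carrier G)" and hs: "h \<in> step_functions (carrier G)"
    using f h' by (auto simp: step_gyrogroup_def)
  note fc = step_functions_value[OF fs] and hc = step_functions_value[OF hs]
  define Q where "Q = {(x, y) \<in> f ` {0..<1} \<times> h ` {0..<1}. inv x \<otimes> y \<in> U}"
  have Q: "finite Q" unfolding Q_def
    using finite_image_step_function[OF fs] finite_image_step_function[OF hs]
    by (auto intro: finite_subset[of _ "f ` {0..<1} \<times> h ` {0..<1}"])
  \<comment> \<open>The preimage of \<open>U\<close> under two successive left translations,
    \<open>z \<mapsto> inv x \<otimes> (y \<otimes> z)\<close> for \<open>p = (x, y)\<close>; it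
    contains \<open>\<one>\<close> because pairs in \<open>Q\<close> satisfy
    \<open>inv x \<otimes> y \<in> U\<close>.\<close>
  define N where "N p = {z \<in> carrier G. snd p \<otimes> z \<in> {u \<in> carrier G. inv (fst p) \<otimes> u \<in> U}}" for p
  have N: "openin T (N p)" "\<one> \<in> N p" if pQ: "p \<in> Q" for p
  proof -
    obtain x y where p: "p = (x, y)" "x \<in> carrier G" "y \<in> carrier G" "inv x \<otimes> y \<in> U"
      using pQ fc hc unfolding Q_def by fastforce
    show "openin T (N p)" unfolding N_def p(1) fst_conv snd_conv
      by (intro openin_preimage_left_mult base_open[OF U] inv_carrier p)
    show "\<one> \<in> N p" unfolding N_def using p one_closed identity by simp
  qed
  \<comment> \<open>Intersecting with \<open>topspace T\<close> keeps \<open>V\<close> open when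
    \<open>Q\<close> is empty and the intersection over it is everything.\<close>
  define V where "V = topspace T \<inter> \<Inter>(N ` Q)"
  \<comment> \<open>The slack that \<open>h\<close> leaves below \<open>\<epsilon>\<close>: the
    exceptional set of \<open>k\<close> relative to \<open>f\<close> is covered by those of
    \<open>h\<close> relative to \<open>f\<close> and of \<open>k\<close> relative to
    \<open>h\<close>.\<close>
  define \<delta> where "\<delta> = \<epsilon> - measure lebesgue {r \<in> {0..<1}. inv (f r) \<otimes> h r \<notin> U}"
  have V: "openin T V"
    unfolding V_def using Q N by (cases "Q = {}") (auto intro!: openin_Inter)
  have V1: "\<one> \<in> V" unfolding V_def using N one_closed topspace_eq by auto
  have "step_ball h V \<delta> \<subseteq> step_ball f U \<epsilon>"
  proof
    fix k assume "k \<in> step_ball h V \<delta>"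
    then have k: "k \<in> carrier (step_gyrogroup G)"
      and lt: "measure lebesgue {r \<in> {0..<1}. inv (h r) \<otimes> k r \<notin> V} < \<delta>"
      using h' by (auto simp: step_translate_eq)
    have ks: "k \<in> step_functions (carrier G)" using k by (simp add: step_gyrogroup_def)
    note kc = step_functions_value[OF ks]
    have meas: "{r \<in> {0..<1}. inv (u r) \<otimes> v r \<notin> W} \<in> lmeasurable"
      if "u \<in> step_functions (carrier G)" "v \<in> step_functions (carrier G)" for u v W
    proof -
      have "(\<lambda>r\<in>{0..<1}. inv (u r) \<otimes> v r) \<in> step_functions (carrier G)"
        using step_functions_combine[OF that, of "\<lambda>x y. inv x \<otimes> y"] closed inv_carrier by simp
      from lmeasurable_step_function[OF this, of "\<lambda>x. x \<notin> W"]
      show ?thesis by (simp cong: conj_cong)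
    qed
    have "inv (f r) \<otimes> k r \<in> U"
      if r: "r \<in> {0..<1}" and "inv (f r) \<otimes> h r \<in> U" "inv (h r) \<otimes> k r \<in> V" for r
    proof -
      have "(f r, h r) \<in> Q" using that unfolding Q_def by auto
      then have "inv (h r) \<otimes> k r \<in> N (f r, h r)" using that unfolding V_def by auto
      then show ?thesis unfolding N_def using inv_mult_cancel(2)[OF hc[OF r] kc[OF r]] by simp
    qed
    then have "measure lebesgue {r \<in> {0..<1}. inv (f r) \<otimes> k r \<notin> U} \<le>
        measure lebesgue ({r \<in> {0..<1}. inv (f r) \<otimes> h r \<notin> U} \<union> {r \<in> {0..<1}. inv (h r) \<otimes> k r \<notin> V})"
      by (intro measure_mono_fmeasurable fmeasurable.Un fmeasurableD meas fs hs ks) auto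
    also have "\<dots> \<le> measure lebesgue {r \<in> {0..<1}. inv (f r) \<otimes> h r \<notin> U} +
        measure lebesgue {r \<in> {0..<1}. inv (h r) \<otimes> k r \<notin> V}"
      by (intro measure_Un_le fmeasurableD meas fs hs ks)
    also have "\<dots> < \<epsilon>" using lt unfolding \<delta>_def by simp
    finally show "k \<in> step_ball f U \<epsilon>" using k f by (simp add: step_translate_eq)
  qed
  then show ?thesis using V V1 less unfolding \<delta>_def by (intro exI[of _ V] exI) auto
qed

lemma step_ball_subset:
  "f \<in> carrier (step_gyrogroup G) \<Longrightarrow> step_ball f U \<epsilon> \<subseteq> carrier (step_gyrogroup G)"
  by (simp add: step_translate_eq)

lemma step_ball_mono:
  assumes "h \<in> carrier (step_gyrogroup G)" "V \<subseteq> V'" "\<delta> \<le> \<delta>'"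
  shows "step_ball h V \<delta> \<subseteq> step_ball h V' \<delta>'"
proof -
  have "step_nbhd G V \<delta> \<subseteq> step_nbhd G V' \<delta>'"
  proof
    fix g assume g: "g \<in> step_nbhd G V \<delta>"
    then have gs: "g \<in> step_functions (carrier G)" by (simp add: step_nbhd_def step_gyrogroup_def)
    have "measure lebesgue {r \<in> {0..<1}. g r \<notin> V'} \<le> measure lebesgue {r \<in> {0..<1}. g r \<notin> V}"
      using assms lmeasurable_step_function[OF gs] by (intro measure_mono_fmeasurable) auto
    then show "g \<in> step_nbhd G V' \<delta>'" using g assms by (simp add: step_nbhd_def)
  qed
  then show ?thesis by blast
qed

text \<open>\<open>topology\<close> is informative only once its argument is known to be a topology.
  Recentring balls turns unions of base sets into sets containing a ball about each of their points,
  and for that form closure under intersections and unions is direct.\<close>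

lemma openin_step_topology:
  "openin (step_topology G \<U>) W \<longleftrightarrow>
     W \<subseteq> carrier (step_gyrogroup G) \<and> (\<forall>h\<in>W. \<exists>U\<in>\<U>. \<exists>\<epsilon>>0. step_ball h U \<epsilon> \<subseteq> W)"
proof -
  let ?open = "\<lambda>W. W \<subseteq> carrier (step_gyrogroup G) \<and> (\<forall>h\<in>W. \<exists>U\<in>\<U>. \<exists>\<epsilon>>0. step_ball h U \<epsilon> \<subseteq> W)"
  have refine: "\<exists>V\<in>\<U>. \<exists>\<delta>>0. step_ball h V \<delta> \<subseteq> step_ball f U \<epsilon>"
    if f: "f \<in> carrier (step_gyrogroup G)" and U: "U \<in> \<U>" and h: "h \<in> step_ball f U \<epsilon>" for f h U \<epsilon>
  proof -
    obtain V \<delta> where V: "openin T V" "\<one> \<in> V" "\<delta> > 0" "step_ball h V \<delta> \<subseteq> step_ball f U \<epsilon>"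
      using step_ball_refine[OF f U h] by blast
    then obtain V' where V': "V' \<in> \<U>" "V' \<subseteq> V" using base_refine by blast
    have "h \<in> carrier (step_gyrogroup G)" using h step_ball_subset[OF f] by (rule subsetD[rotated])
    then have "step_ball h V' \<delta> \<subseteq> step_ball f U \<epsilon>"
      using order_trans[OF step_ball_mono[OF _ V'(2) order.refl] V(4)] by simp
    then show ?thesis using V'(1) V(3) by (intro bexI[of _ V'] exI[of _ \<delta>] conjI)
  qed
  have eq: "arbitrary union_of (\<lambda>S. S \<in> step_base G \<U>) = ?open"
  proof (intro ext iffI)
    fix W assume "(arbitrary union_of (\<lambda>S. S \<in> step_base G \<U>)) W"
    then have W: "\<exists>B. B \<in> step_base G \<U> \<and> x \<in> B \<and> B \<subseteq> W" if "x \<in> W" for x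
      using that unfolding arbitrary_union_of_alt by blast
    have "x \<in> carrier (step_gyrogroup G) \<and> (\<exists>U\<in>\<U>. \<exists>\<epsilon>>0. step_ball x U \<epsilon> \<subseteq> W)" if x: "x \<in> W" for x
    proof -
      obtain f U \<epsilon> where f: "f \<in> carrier (step_gyrogroup G)" "U \<in> \<U>" "x \<in> step_ball f U \<epsilon>"
        "step_ball f U \<epsilon> \<subseteq> W"
        using W[OF x] unfolding step_base_def by blast
      then obtain V \<delta> where "V \<in> \<U>" "\<delta> > 0" "step_ball x V \<delta> \<subseteq> step_ball f U \<epsilon>"
        using refine[OF f(1-3)] by blast
      then show ?thesis using f(3,4) step_ball_subset[OF f(1)]
        by (meson order_trans subsetD)
    qed
    then show "?open W" by blast
  next
    fix W assume W: "?open W"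
    show "(arbitrary union_of (\<lambda>S. S \<in> step_base G \<U>)) W"
      unfolding arbitrary_union_of_alt
    proof
      fix h assume h: "h \<in> W"
      then obtain U \<epsilon> where U: "U \<in> \<U>" "\<epsilon> > 0" "step_ball h U \<epsilon> \<subseteq> W" using W by blast
      moreover have "h \<in> carrier (step_gyrogroup G)" using h W by blast
      ultimately show "\<exists>B. B \<in> step_base G \<U> \<and> h \<in> B \<and> B \<subseteq> W"
        using step_ball_centre[of h U \<epsilon>] unfolding step_base_def by blast
    qed
  qed
  have "istopology ?open"
    unfolding istopology_def
  proof (intro conjI allI impI)
    fix W W' assume W: "?open W" and W': "?open W'"
    show "W \<inter> W' \<subseteq> carrier (step_gyrogroup G)" using W by blast
    show "\<forall>h\<in>W \<inter> W'. \<exists>U\<in>\<U>. \<exists>\<epsilon>>0. step_ball h U \<epsilon> \<subseteq> W \<inter> W'"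
    proof
      fix h assume h: "h \<in> W \<inter> W'"
      then obtain U \<epsilon> U' \<epsilon>' where U: "U \<in> \<U>" "\<epsilon> > 0" "step_ball h U \<epsilon> \<subseteq> W"
        "U' \<in> \<U>" "\<epsilon>' > 0" "step_ball h U' \<epsilon>' \<subseteq> W'"
        using W W' by (metis Int_iff)
      have "openin T (U \<inter> U')" "\<one> \<in> U \<inter> U'"
        using base_open base_one U(1,4) by (auto intro: openin_Int)
      then obtain V where V: "V \<in> \<U>" "V \<subseteq> U" "V \<subseteq> U'" using base_refine by (metis le_inf_iff)
      have hc: "h \<in> carrier (step_gyrogroup G)" using h W by blast
      have "step_ball h V (min \<epsilon> \<epsilon>') \<subseteq> W \<inter> W'"
        using order_trans[OF step_ball_mono[OF hc V(2) min.cobounded1] U(3)]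
          order_trans[OF step_ball_mono[OF hc V(3) min.cobounded2] U(6)]
        by (rule Int_greatest)
      then show "\<exists>U\<in>\<U>. \<exists>\<epsilon>>0. step_ball h U \<epsilon> \<subseteq> W \<inter> W'"
        using V(1) U(2,5) by (intro bexI[of _ V] exI[of _ "min \<epsilon> \<epsilon>'"]) simp
    qed
  next
    fix \<K> assume K: "\<forall>W\<in>\<K>. ?open W"
    then show "\<Union>\<K> \<subseteq> carrier (step_gyrogroup G)" by blast
    show "\<forall>h\<in>\<Union>\<K>. \<exists>U\<in>\<U>. \<exists>\<epsilon>>0. step_ball h U \<epsilon> \<subseteq> \<Union>\<K>"
    proof
      fix h assume "h \<in> \<Union>\<K>"
      then obtain W where W: "W \<in> \<K>" "h \<in> W" by blast
      then obtain U \<epsilon> where "U \<in> \<U>" "\<epsilon> > 0" "step_ball h U \<epsilon> \<subseteq> W" using K by blast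
      then show "\<exists>U\<in>\<U>. \<exists>\<epsilon>>0. step_ball h U \<epsilon> \<subseteq> \<Union>\<K>"
        using Union_upper[OF W(1)] by (meson order_trans)
    qed
  qed
  then show ?thesis unfolding step_topology_def eq by (simp add: topology_inverse')
qed

lemma topspace_step_topology: "topspace (step_topology G \<U>) = carrier (step_gyrogroup G)"
proof -
  have "openin (step_topology G \<U>) (carrier (step_gyrogroup G))"
    unfolding openin_step_topology
    using base_nonempty by (auto simp: step_translate_eq intro!: exI[of _ 1])
  then show ?thesis using openin_step_topology openin_topspace openin_subset by (metis subset_antisym)
qed

section \<open>Constants in the step topology: embedding and closedness\<close>

text \<open>The exceptional set of two constants is empty or all of \<open>{0..<1}\<close>, so its
  measure is 0 or 1. A radius above 1 would admit every constant.\<close>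

lemma const_step_in_step_ball_iff:
  assumes "x \<in> carrier G" "y \<in> carrier G" "0 < \<epsilon>" "\<epsilon> \<le> 1"
  shows "const_step y \<in> step_ball (const_step x) U \<epsilon> \<longleftrightarrow> inv x \<otimes> y \<in> U"
proof -
  have "{r \<in> {0..<1}. inv (const_step x r) \<otimes> const_step y r \<notin> U} =
      (if inv x \<otimes> y \<in> U then {} else {0..<1})"
    by (auto simp: const_step_def)
  then have "measure lebesgue {r \<in> {0..<1}. inv (const_step x r) \<otimes> const_step y r \<notin> U} < \<epsilon> \<longleftrightarrow>
      inv x \<otimes> y \<in> U"
    using assms by simp
  then show ?thesis using assms const_step_carrier by (simp add: step_translate_eq)
qed

lemma embedding_map_const_step: "embedding_map T (step_topology G \<U>) const_step"
proof -
  let ?S = "step_topology G \<U>"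
  note cs = const_step_carrier
  have inj: "inj const_step"
    by (intro injI) (metis atLeastLessThan_iff const_step_def order.refl restrict_apply' zero_less_one)
  have cont: "continuous_map T ?S const_step"
    unfolding continuous_map_def
  proof (intro conjI allI impI)
    show "const_step \<in> topspace T \<rightarrow> topspace ?S"
      using cs by (simp add: topspace_eq topspace_step_topology)
    fix W assume W: "openin ?S W"
    show "openin T {x \<in> topspace T. const_step x \<in> W}" (is "openin T ?A")
    proof (subst openin_subopen, intro ballI)
      fix x assume "x \<in> ?A"
      then have x: "x \<in> carrier G" "const_step x \<in> W" by (auto simp: topspace_eq)
      then obtain U \<epsilon> where U: "U \<in> \<U>" "\<epsilon> > 0" "step_ball (const_step x) U \<epsilon> \<subseteq> W"
        using W unfolding openin_step_topology by blast
      \<comment> \<open>The radius is cut down to 1 so that the ball detects \<open>U\<close> on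
        constants.\<close>
      have sub: "step_ball (const_step x) U (min \<epsilon> 1) \<subseteq> W"
        using U step_ball_mono[OF cs[OF x(1)], of U U "min \<epsilon> 1" \<epsilon>] by auto
      show "\<exists>V. openin T V \<and> x \<in> V \<and> V \<subseteq> ?A"
      proof (intro exI conjI)
        show "openin T {y \<in> carrier G. inv x \<otimes> y \<in> U}"
          using openin_preimage_left_mult base_open U inv_carrier x by blast
        show "x \<in> {y \<in> carrier G. inv x \<otimes> y \<in> U}"
          using x inv_left base_one U by simp
        show "{y \<in> carrier G. inv x \<otimes> y \<in> U} \<subseteq> ?A"
          using const_step_in_step_ball_iff[OF x(1), of _ "min \<epsilon> 1" U] U sub
          by (auto simp: topspace_eq)
      qed
    qed
  qed
  have "open_map T (subtopology ?S (const_step ` topspace T)) const_step"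
    unfolding open_map_def
  proof (intro allI impI)
    fix A assume A: "openin T A"
    have Ac: "A \<subseteq> carrier G" using openin_subset[OF A] topspace_eq by simp
    \<comment> \<open>An open set whose trace on the constants is the image of \<open>A\<close>: it
      collects the balls around constants from \<open>A\<close> that meet the constants only inside
      that image. Radius 1 lies in the range where a ball detects \<open>U\<close> on
      constants.\<close>
    define W where "W = {h \<in> carrier (step_gyrogroup G). \<exists>x\<in>A. \<exists>U\<in>\<U>. h \<in> step_ball (const_step x) U 1 \<and>
        {z \<in> carrier G. inv x \<otimes> z \<in> U} \<subseteq> A}"
    have "openin ?S W"
      unfolding openin_step_topology
    proof (intro conjI ballI)
      show "W \<subseteq> carrier (step_gyrogroup G)" unfolding W_def by blast
      fix h assume "h \<in> W"
      then obtain x U where x: "x \<in> A" "U \<in> \<U>" "h \<in> step_ball (const_step x) U 1"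
        "{z \<in> carrier G. inv x \<otimes> z \<in> U} \<subseteq> A" unfolding W_def by blast
      have xc: "const_step x \<in> carrier (step_gyrogroup G)" using cs x Ac by blast
      obtain V \<delta> where V: "openin T V" "\<one> \<in> V" "\<delta> > 0"
        "step_ball h V \<delta> \<subseteq> step_ball (const_step x) U 1"
        using step_ball_refine[OF xc x(2,3)] by blast
      obtain V' where V': "V' \<in> \<U>" "V' \<subseteq> V" using base_refine V by blast
      have hc: "h \<in> carrier (step_gyrogroup G)" using x xc by (simp add: step_translate_eq)
      have "step_ball h V' \<delta> \<subseteq> step_ball (const_step x) U 1"
        using step_ball_mono[OF hc V'(2), of \<delta> \<delta>] V by simp
      \<comment> \<open>All points of this ball belong to \<open>W\<close> with the same witnesses
        \<open>x\<close> and \<open>U\<close>.\<close>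
      also have "\<dots> \<subseteq> W" using x step_ball_subset[OF xc] unfolding W_def by blast
      finally show "\<exists>U\<in>\<U>. \<exists>\<epsilon>>0. step_ball h U \<epsilon> \<subseteq> W" using V(3) V'(1) by meson
    qed
    moreover have "const_step ` A = const_step ` topspace T \<inter> W"
    proof
      show "const_step ` A \<subseteq> const_step ` topspace T \<inter> W"
      proof
        fix f assume "f \<in> const_step ` A"
        then obtain x where x: "x \<in> A" "f = const_step x" by blast
        then have xc: "x \<in> carrier G" using Ac by blast
        \<comment> \<open>The neighbourhood of \<open>x\<close> inside \<open>A\<close> is moved to
          \<open>\<one>\<close>, where the base \<open>\<U>\<close> applies.\<close>
        have "openin T {z \<in> carrier G. x \<otimes> z \<in> A}" "\<one> \<in> {z \<in> carrier G. x \<otimes> z \<in> A}"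
          using openin_preimage_left_mult[OF A xc] one_closed identity[OF xc] x by auto
        then obtain U where U: "U \<in> \<U>" "U \<subseteq> {z \<in> carrier G. x \<otimes> z \<in> A}" using base_refine by meson
        have "{z \<in> carrier G. inv x \<otimes> z \<in> U} \<subseteq> A"
        proof
          fix z assume "z \<in> {z \<in> carrier G. inv x \<otimes> z \<in> U}"
          then have "z \<in> carrier G" "x \<otimes> (inv x \<otimes> z) \<in> A" using U by auto
          then show "z \<in> A" using inv_mult_cancel(2)[OF xc] by simp
        qed
        moreover have "const_step x \<in> step_ball (const_step x) U 1"
          using step_ball_centre cs xc U by simp
        ultimately show "f \<in> const_step ` topspace T \<inter> W"
          using x xc U cs unfolding W_def by (auto simp: topspace_eq)
      qed
      show "const_step ` topspace T \<inter> W \<subseteq> const_step ` A"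
      proof
        fix f assume "f \<in> const_step ` topspace T \<inter> W"
        then obtain y where y: "y \<in> carrier G" "f = const_step y" "const_step y \<in> W"
          by (auto simp: topspace_eq)
        then obtain x U where x: "x \<in> A" "const_step y \<in> step_ball (const_step x) U 1"
          "{z \<in> carrier G. inv x \<otimes> z \<in> U} \<subseteq> A" unfolding W_def by blast
        then have "inv x \<otimes> y \<in> U" using const_step_in_step_ball_iff[of x y 1 U] y Ac by auto
        then show "f \<in> const_step ` A" using x y by auto
      qed
    qed
    ultimately show "openin (subtopology ?S (const_step ` topspace T)) (const_step ` A)"
      unfolding openin_subtopology_alt by blast
  qed
  moreover have "continuous_map T (subtopology ?S (const_step ` topspace T)) const_step"
    using cont by (auto simp: continuous_map_in_subtopology)
  moreover have "const_step ` topspace T = topspace (subtopology ?S (const_step ` topspace T))"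
    using continuous_map_image_subset_topspace[OF cont] by auto
  moreover have "inj_on const_step (topspace T)" by (rule inj_on_subset[OF inj subset_UNIV])
  ultimately show ?thesis
    unfolding embedding_map_def by (intro bijective_open_imp_homeomorphic_map)
qed

text \<open>Two distinct values of a nonconstant \<open>f\<close> are attained on sets of measure at least \<open>\<delta>\<close>,
  so a constant \<open>\<delta>\<close>-close to \<open>f\<close> would lie in both of two disjoint translates of \<open>V\<close>.\<close>

lemma closedin_const_step:
  assumes t0: "t0_space T"
  shows "closedin (step_topology G \<U>) (const_step ` carrier G)"
  unfolding closedin_def topspace_step_topology openin_step_topology
proof (intro conjI ballI)
  show "const_step ` carrier G \<subseteq> carrier (step_gyrogroup G)" by (auto simp: step_gyrogroup_def)
  show "carrier (step_gyrogroup G) - const_step ` carrier G \<subseteq> carrier (step_gyrogroup G)" by blast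
  fix f assume f: "f \<in> carrier (step_gyrogroup G) - const_step ` carrier G"
  then have fs: "f \<in> step_functions (carrier G)" by (simp add: step_gyrogroup_def)
  note fc = step_functions_value[OF fs]
  have "\<exists>s\<in>{0..<1}. f s \<noteq> f 0"
  proof (rule ccontr)
    assume const: "\<not> ?thesis"
    have eq: "f r = const_step (f 0) r" if r: "r \<in> {0..<1}" for r
    proof -
      have "f r = f 0" using const r by blast
      then show ?thesis using r by (simp add: const_step_def)
    qed
    have f0: "f 0 \<in> carrier G" using fc[of 0] by simp
    have "f = const_step (f 0)"
      by (rule step_functions_eqI[OF fs const_step_in_step_functions[OF f0]]) (rule eq)
    then have "f \<in> const_step ` carrier G" using f0 by (rule image_eqI)
    then show False using f by blast
  qed
  then obtain s where s: "s \<in> {0..<1}" "f s \<noteq> f 0" by blast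
  obtain V where V: "openin T V" "\<one> \<in> V" "\<And>v w. v \<in> V \<Longrightarrow> w \<in> V \<Longrightarrow> f s \<otimes> v \<noteq> f 0 \<otimes> w"
    using separate_translates[OF t0 fc fc, of s 0] s by auto
  obtain U where U: "U \<in> \<U>" "U \<subseteq> V" using base_refine V by blast
  \<comment> \<open>Both level sets have measure at least \<open>\<delta>\<close>, so neither fits
    into an exceptional set of measure below \<open>\<delta>\<close>.\<close>
  define \<delta> where "\<delta> = min (measure lebesgue {t \<in> {0..<1}. f t = f s}) (measure lebesgue {t \<in> {0..<1}. f t = f 0})"
  have \<delta>: "\<delta> > 0" unfolding \<delta>_def using measure_level_set_pos[OF fs] s by simp
  have False if x: "x \<in> carrier G" and ball: "const_step x \<in> step_ball f U \<delta>" for x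
  proof -
    have lt: "measure lebesgue {r \<in> {0..<1}. inv (f r) \<otimes> const_step x r \<notin> U} < \<delta>"
      using ball f by (simp add: step_translate_eq)
    have eq: "{r \<in> {0..<1}. inv (f r) \<otimes> const_step x r \<notin> U} = {r \<in> {0..<1}. inv (f r) \<otimes> x \<notin> U}"
      by (auto simp: const_step_def)
    \<comment> \<open>For constant \<open>x\<close> the condition depends on \<open>r\<close> only
      through \<open>f r\<close>, so failing at \<open>r\<close> means failing on its whole level
      set.\<close>
    have in_U: "inv (f r) \<otimes> x \<in> U" if r: "\<delta> \<le> measure lebesgue {t \<in> {0..<1}. f t = f r}" for r
    proof (rule ccontr)
      assume "inv (f r) \<otimes> x \<notin> U"
      then have "measure lebesgue {t \<in> {0..<1}. f t = f r} \<le>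
          measure lebesgue {r \<in> {0..<1}. inv (f r) \<otimes> x \<notin> U}"
        using lmeasurable_step_function[OF fs, of "\<lambda>y. y = f r"]
          lmeasurable_step_function[OF fs, of "\<lambda>y. inv y \<otimes> x \<notin> U"]
        by (intro measure_mono_fmeasurable) auto
      then show False using lt eq r by simp
    qed
    have "f s \<otimes> (inv (f s) \<otimes> x) \<noteq> f 0 \<otimes> (inv (f 0) \<otimes> x)"
      by (intro V(3) subsetD[OF U(2)] in_U) (simp_all add: \<delta>_def)
    then show False
      using inv_mult_cancel(2)[OF fc[OF s(1)] x] inv_mult_cancel(2)[OF fc[of 0] x] by simp
  qed
  moreover have "step_ball f U \<delta> \<subseteq> carrier (step_gyrogroup G)" using f step_ball_subset by blast
  ultimately have "step_ball f U \<delta> \<subseteq> carrier (step_gyrogroup G) - const_step ` carrier G" by blast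
  then show "\<exists>U\<in>\<U>. \<exists>\<epsilon>>0. step_ball f U \<epsilon> \<subseteq> carrier (step_gyrogroup G) - const_step ` carrier G"
    using U(1) \<delta> by meson
qed

end

theorem theorem3p6:
  fixes G :: "('a, 'b) monoid_scheme" and T :: "'a topology" and \<U> :: "'a set set"
  assumes "topological_gyrogroup G T"
    and "open_base_at T \<one>\<^bsub>G\<^esub> \<U>"
  shows "embedding_map T (step_topology G \<U>) const_step \<and>
    subgyrogroup (const_step ` carrier G) (step_gyrogroup G) \<and>
    (t0_space T \<longrightarrow> closedin (step_topology G \<U>) (const_step ` carrier G))"
proof -
  interpret topological_gyrogroup_base G T \<U>
    using assms by (simp add: topological_gyrogroup_base_def topological_gyrogroup_base_axioms_def)
  show ?thesis
    using embedding_map_const_step subgyrogroup_const_step closedin_const_step by blast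
qed

end
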